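(* Let $\mathcal{G}$ be a connected finite undirected graph with vertex set $\{1,\dots,n\}$ and neighbor sets $\mathbf{N}_i$. For adjacent $i,j$ let $\alpha_{ij}=\alpha_{ji}>0$ and $\beta_{ij}=-\beta_{ji}\in\mathbb{R}$; for each $i$ let $\xi_i>0$, $\zeta_i\in\mathbb{R}$, $p_i^d\in\mathbb{R}$. Let $\mathcal{L}_{\mathcal{G}}$ be the weighted Laplacian of $\mathcal{G}$ with edge weights $\frac{1}{4\alpha_{ij}}$, let $\mathcal{L}_{\mathcal{G}}^k$ be the weighted Laplacian of the complete graph on $\{1,\dots,n\}$ with weight $$\frac{1/(2\xi_j)}{\xi_i\sum_{l=1}^n\frac{1}{\xi_l}}$$ for the $(i,j)$ element, $i\ne j$, and let $\mathbf{w}_J\in\mathbb{R}^n$ have $i$-th element $$-\sum_{j\in\mathbf{N}_i}\frac{\beta_{ij}}{2\alpha_{ij}}-\frac{\zeta_i}{2\xi_i}-p_i^d+\frac{\sum_{j=1}^n\left\{\frac{\zeta_j}{2\xi_j}+p_j^d\right\}}{\xi_i\sum_{j=1}^n\frac{1}{\xi_j}}.$$ Then every solution $\lambda^v(t)\in\mathbb{R}^n$, $t\ge0$, of $$\dot\lambda^v=-(\mathcal{L}_{\mathcal{G}}+\mathcal{L}_{\mathcal{G}}^k)\lambda^v+\mathbf{w}_J$$ converges as $t\to\infty$ to a constant vector, and this limit is a solution of $(\mathcal{L}_{\mathcal{G}}+\mathcal{L}_{\mathcal{G}}^k)\lambda^v-\mathbf{w}_J=0$.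
   Context: For a graph with symmetric weights $a_{ij}$ ($a_{ij}=0$ for non-adjacent $i\neq j$ and $a_{ii}=0$), the weighted Laplacian is $D-A$, where $A=(a_{ij})$ is the adjacency matrix and $D$ is the diagonal matrix with $D(i,i)=\sum_{j\ne i}a_{ij}$. *)

theory Defs
  imports "HOL-Analysis.Analysis"
begin

text \<open>
  The vertex set \<open>{1,\<dots>,n}\<close> is represented by a finite index type \<open>'n\<close>, and a graph by its
  set of ordered adjacent pairs, so that an undirected edge occurs in both orientations.
\<close>

definition simple_graph :: "('n \<times> 'n) set \<Rightarrow> bool" where
  "simple_graph E \<longleftrightarrow> sym E \<and> irrefl E"

definition connected_graph :: "('n \<times> 'n) set \<Rightarrow> bool" where
  "connected_graph E \<longleftrightarrow> (\<forall>i j. (i, j) \<in> E\<^sup>*)"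

definition neighbors :: "('n \<times> 'n) set \<Rightarrow> 'n \<Rightarrow> 'n set" where
  "neighbors E i = {j. (i, j) \<in> E}"

definition complete_graph :: "('n \<times> 'n) set" where
  "complete_graph = {(i, j). i \<noteq> j}"

definition adjacency_matrix ::
    "('n::finite \<times> 'n) set \<Rightarrow> ('n \<Rightarrow> 'n \<Rightarrow> real) \<Rightarrow> real ^ 'n ^ 'n" where
  "adjacency_matrix E a = (\<chi> i j. if i \<noteq> j \<and> j \<in> neighbors E i then a i j else 0)"

definition degree_matrix ::
    "('n::finite \<times> 'n) set \<Rightarrow> ('n \<Rightarrow> 'n \<Rightarrow> real) \<Rightarrow> real ^ 'n ^ 'n" where
  "degree_matrix E a =
    (\<chi> i j. if i = j then \<Sum>k\<in>UNIV - {i}. adjacency_matrix E a $ i $ k else 0)"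

definition weighted_laplacian ::
    "('n::finite \<times> 'n) set \<Rightarrow> ('n \<Rightarrow> 'n \<Rightarrow> real) \<Rightarrow> real ^ 'n ^ 'n" where
  "weighted_laplacian E a = degree_matrix E a - adjacency_matrix E a"

definition L_G :: "('n::finite \<times> 'n) set \<Rightarrow> ('n \<Rightarrow> 'n \<Rightarrow> real) \<Rightarrow> real ^ 'n ^ 'n" where
  "L_G E \<alpha> = weighted_laplacian E (\<lambda>i j. 1 / (4 * \<alpha> i j))"

definition L_G_k :: "('n::finite \<Rightarrow> real) \<Rightarrow> real ^ 'n ^ 'n" where
  "L_G_k \<xi> = weighted_laplacian complete_graph
     (\<lambda>i j. (1 / (2 * \<xi> j)) / (\<xi> i * (\<Sum>l\<in>UNIV. 1 / \<xi> l)))"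

definition w_J :: "('n::finite \<times> 'n) set \<Rightarrow> ('n \<Rightarrow> 'n \<Rightarrow> real) \<Rightarrow> ('n \<Rightarrow> 'n \<Rightarrow> real)
    \<Rightarrow> ('n \<Rightarrow> real) \<Rightarrow> ('n \<Rightarrow> real) \<Rightarrow> ('n \<Rightarrow> real) \<Rightarrow> real ^ 'n" where
  "w_J E \<alpha> \<beta> \<xi> \<zeta> pd = (\<chi> i.
     - (\<Sum>j\<in>neighbors E i. \<beta> i j / (2 * \<alpha> i j)) - \<zeta> i / (2 * \<xi> i) - pd i
     + (\<Sum>j\<in>UNIV. \<zeta> j / (2 * \<xi> j) + pd j) / (\<xi> i * (\<Sum>j\<in>UNIV. 1 / \<xi> j)))"

end

theory Submission
  imports Defs
begin

text \<open>
  The matrix \<open>M = L_G E \<alpha> + L_G_k \<xi>\<close> is symmetric with \<open>1 \<bullet> M v = 0\<close>, and \<open>1 \<bullet> w_J = 0\<close>, so the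
  component sum of a solution is conserved. The complete graph alone makes \<open>M\<close> positive definite
  on the vectors with component sum zero. Hence \<open>v \<mapsto> M v + (1 \<bullet> v) 1\<close> is bijective, which gives an
  equilibrium with the component sum of the solution, and the squared distance to it decays
  exponentially.
\<close>

section \<open>Weighted Laplacians: component sums and quadratic forms\<close>

lemma sum_antisym_eq_0:
  fixes f :: "'n::finite \<Rightarrow> 'n \<Rightarrow> real"
  assumes "\<And>i j. f i j = - f j i"
  shows "(\<Sum>i\<in>UNIV. \<Sum>j\<in>UNIV. f i j) = 0"
proof -
  have "(\<Sum>i\<in>UNIV. \<Sum>j\<in>UNIV. f i j) = (\<Sum>i\<in>UNIV. \<Sum>j\<in>UNIV. f j i)"
    by (rule sum.swap)
  also have "\<dots> = - (\<Sum>i\<in>UNIV. \<Sum>j\<in>UNIV. f i j)"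
    by (subst assms) (simp add: sum_negf)
  finally show ?thesis by simp
qed

lemma weighted_laplacian_mult_component:
  "(weighted_laplacian E a *v v) $ i
    = (\<Sum>j\<in>UNIV. adjacency_matrix E a $ i $ j * (v $ i - v $ j))"
proof -
  have "(\<Sum>k\<in>UNIV - {i}. adjacency_matrix E a $ i $ k) = (\<Sum>k\<in>UNIV. adjacency_matrix E a $ i $ k)"
    by (rule sum.mono_neutral_left) (auto simp: adjacency_matrix_def)
  then have "(degree_matrix E a *v v) $ i = (\<Sum>k\<in>UNIV. adjacency_matrix E a $ i $ k) * v $ i"
    by (simp add: degree_matrix_def matrix_vector_mult_def if_distrib[of "\<lambda>x. x * _"] cong: if_cong)
  then show ?thesis
    by (simp add: weighted_laplacian_def matrix_vector_mult_diff_rdistrib right_diff_distrib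
        sum_subtractf sum_distrib_right) (simp add: matrix_vector_mult_def)
qed

lemma sum_weighted_laplacian_mult:
  assumes "\<And>i j. adjacency_matrix E a $ i $ j = adjacency_matrix E a $ j $ i"
  shows "(\<Sum>i\<in>UNIV. (weighted_laplacian E a *v v) $ i) = 0"
  unfolding weighted_laplacian_mult_component
  by (rule sum_antisym_eq_0) (metis assms minus_diff_eq mult_minus_right)

lemma weighted_laplacian_quadratic_form:
  assumes sym: "\<And>i j. adjacency_matrix E a $ i $ j = adjacency_matrix E a $ j $ i"
  shows "v \<bullet> (weighted_laplacian E a *v v)
    = (\<Sum>i\<in>UNIV. \<Sum>j\<in>UNIV. adjacency_matrix E a $ i $ j * (v $ i - v $ j)\<^sup>2) / 2"
proof -
  let ?A = "\<lambda>i j. adjacency_matrix E a $ i $ j"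
  \<comment> \<open>For symmetric weights each summand equals
    \<open>?A i j * ((v $ i)^2 - (v $ j)^2) / 2\<close>, which changes sign when \<open>i\<close>
    and \<open>j\<close> are swapped.\<close>
  have "(\<Sum>i\<in>UNIV. \<Sum>j\<in>UNIV.
      v $ i * (?A i j * (v $ i - v $ j)) - ?A i j * (v $ i - v $ j)\<^sup>2 / 2) = 0"
  proof (rule sum_antisym_eq_0)
    fix i j
    show "v $ i * (?A i j * (v $ i - v $ j)) - ?A i j * (v $ i - v $ j)\<^sup>2 / 2
      = - (v $ j * (?A j i * (v $ j - v $ i)) - ?A j i * (v $ j - v $ i)\<^sup>2 / 2)"
      by (simp add: sym[of j i] field_simps power2_eq_square)
  qed
  then show ?thesis
    by (simp add: inner_vec_def weighted_laplacian_mult_component sum_subtractf sum_distrib_left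
        sum_divide_distrib)
qed

text \<open>Expanding the square, the mixed terms add up to a multiple of the squared component sum
  and vanish; each pure square is counted once per value of the other index.\<close>

lemma sum_diff_squares:
  fixes v :: "real ^ 'n"
  assumes "(\<Sum>i\<in>UNIV. v $ i) = 0"
  shows "(\<Sum>i\<in>UNIV. \<Sum>j\<in>UNIV. (v $ i - v $ j)\<^sup>2) = 2 * real CARD('n) * (norm v)\<^sup>2"
proof -
  have "(\<Sum>i\<in>UNIV. \<Sum>j\<in>UNIV. v $ i * v $ j) = 0"
    by (simp add: sum_distrib_left[symmetric] assms)
  then have "(\<Sum>i\<in>UNIV. \<Sum>j\<in>UNIV. (v $ i - v $ j)\<^sup>2)
      = 2 * real CARD('n) * (\<Sum>i\<in>UNIV. (v $ i)\<^sup>2)"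
    by (simp add: power2_diff sum.distrib sum_subtractf mult.assoc sum_distrib_left[symmetric])
  then show ?thesis
    by (simp add: power2_norm_eq_inner inner_vec_def power2_eq_square[of "_ $ _"])
qed

section \<open>Exponential decay, equilibria and convergence of the flow\<close>

lemma exp_decay_of_derivative_le:
  fixes V V' :: "real \<Rightarrow> real"
  assumes deriv: "\<And>t. t \<ge> 0 \<Longrightarrow> (V has_real_derivative V' t) (at t within {0..})"
    and le: "\<And>t. t \<ge> 0 \<Longrightarrow> V' t \<le> - c * V t"
    and "t \<ge> 0"
  shows "V t \<le> V 0 * exp (- c * t)"
proof -
  \<comment> \<open>Integrating factor: the differential inequality says exactly that
    \<open>?U\<close> has nonpositive derivative.\<close>
  let ?U = "\<lambda>t. V t * exp (c * t)"
  have U: "(?U has_real_derivative (V' t + c * V t) * exp (c * t)) (at t within {0..})"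
    if "t \<ge> 0" for t
    by (rule derivative_eq_intros deriv[OF that] refl)+ (simp add: algebra_simps)
  have "?U t \<le> ?U 0"
  proof (rule DERIV_nonpos_imp_decreasing_open[OF \<open>t \<ge> 0\<close>])
    fix x assume x: "0 < x" "x < t"
    \<comment> \<open>The one-sided derivative matters only at 0; there continuity of
      \<open>?U\<close> suffices for monotonicity.\<close>
    then have "at x within {0..} = at x"
      by (intro at_within_interior) simp
    moreover have "(V' x + c * V x) * exp (c * x) \<le> 0"
      using le[of x] x by (intro mult_nonpos_nonneg) auto
    ultimately show "\<exists>y. (?U has_real_derivative y) (at x) \<and> y \<le> 0"
      using U[of x] x by auto
  next
    have "continuous_on {0..} ?U"
      using U by (intro DERIV_continuous_on) auto
    then show "continuous_on {0..t} ?U"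
      by (rule continuous_on_subset) auto
  qed
  then show ?thesis
    by (simp add: exp_minus field_simps)
qed

lemma consensus_equilibrium_exists:
  fixes M :: "real ^ 'n ^ 'n"
  assumes sum0: "\<And>v. (\<Sum>i\<in>UNIV. (M *v v) $ i) = 0"
    and pos: "\<And>v. (\<Sum>i\<in>UNIV. v $ i) = 0 \<Longrightarrow> v \<bullet> (M *v v) \<ge> \<kappa> * (norm v)\<^sup>2"
    and "\<kappa> > 0"
    and w: "(\<Sum>i\<in>UNIV. w $ i) = 0"
  obtains l where "M *v l = w" and "(\<Sum>i\<in>UNIV. l $ i) = c"
proof -
  define f where "f v = M *v v + (\<Sum>i\<in>UNIV. v $ i) *\<^sub>R 1" for v :: "real ^ 'n"
  have lin: "linear f"
    by (rule linearI)
      (simp_all add: f_def matrix_vector_right_distrib matrix_vector_mult_scaleR sum.distrib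
        scaleR_left_distrib scaleR_right_distrib sum_distrib_left[symmetric])
  \<comment> \<open>Since \<open>M\<close> contributes nothing to component sums, \<open>f\<close>
    multiplies them by the dimension. A kernel vector thus has sum zero, which is where coercivity
    applies.\<close>
  have sum_f: "(\<Sum>i\<in>UNIV. f v $ i) = real CARD('n) * (\<Sum>i\<in>UNIV. v $ i)" for v
    by (simp add: f_def sum.distrib sum0)
  have "inj f"
    unfolding linear_injective_0[OF lin]
  proof (intro allI impI)
    fix v assume v: "f v = 0"
    with sum_f[of v] have "(\<Sum>i\<in>UNIV. v $ i) = 0" by simp
    with v pos[of v] have "\<kappa> * (norm v)\<^sup>2 \<le> 0" by (simp add: f_def)
    with \<open>\<kappa> > 0\<close> show "v = 0" by (simp add: mult_le_0_iff)
  qed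
  then have "surj f"
    using lin linear_injective_imp_surjective by blast
  \<comment> \<open>The right-hand side has component sum \<open>c\<close> times the dimension. This
    forces \<open>l\<close> to have sum \<open>c\<close>, so the rank-one terms cancel and
    \<open>M *v l = w\<close> remains.\<close>
  then obtain l where l: "f l = w + c *\<^sub>R 1"
    by (metis surjD)
  with sum_f[of l] have "(\<Sum>i\<in>UNIV. l $ i) = c"
    by (simp add: sum.distrib w)
  with l show ?thesis
    by (intro that[of l]) (simp_all add: f_def)
qed

lemma consensus_flow_converges:
  fixes M :: "real ^ 'n ^ 'n"
  assumes sum0: "\<And>v. (\<Sum>i\<in>UNIV. (M *v v) $ i) = 0"
    and pos: "\<And>v. (\<Sum>i\<in>UNIV. v $ i) = 0 \<Longrightarrow> v \<bullet> (M *v v) \<ge> \<kappa> * (norm v)\<^sup>2"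
    and \<kappa>: "\<kappa> > 0"
    and w: "(\<Sum>i\<in>UNIV. w $ i) = 0"
    and ode: "\<And>t. t \<ge> 0 \<Longrightarrow> (x has_vector_derivative (- M *v x t + w)) (at t within {0..})"
  shows "\<exists>l. (x \<longlongrightarrow> l) at_top \<and> M *v l - w = 0"
proof -
  \<comment> \<open>In the equation the minus sign binds to the matrix, so \<open>- M *v x t\<close>
    reads \<open>(- M) *v x t\<close>.\<close>
  have minus: "(- M) *v v = - (M *v v)" for v
    by (simp add: matrix_vector_mult_def vec_eq_iff sum_negf)
  define s where "s v = (\<Sum>i\<in>UNIV. v $ i)" for v :: "real ^ 'n"
  have s: "bounded_linear s"
    unfolding s_def by (intro bounded_linear_sum bounded_linear_vec_nth)
  have "((\<lambda>t. s (x t)) has_vector_derivative 0) (at t within {0..})" if "t \<ge> 0" for t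
    using bounded_linear.has_vector_derivative[OF s ode[OF that]]
    by (simp add: s_def minus sum_subtractf sum0 w)
  then obtain c where c: "\<And>t. t \<ge> 0 \<Longrightarrow> s (x t) = c"
    using has_vector_derivative_zero_constant[of "{0..}" "\<lambda>t. s (x t)"] by auto
  \<comment> \<open>Matching the conserved sum of the trajectory keeps the error \<open>?e\<close>
    in the sum-zero subspace, where \<open>M\<close> is coercive.\<close>
  obtain l where l: "M *v l = w" "s l = c"
    using consensus_equilibrium_exists[OF sum0 pos \<kappa> w] unfolding s_def by metis
  let ?e = "\<lambda>t. x t - l"
  have e: "(?e has_vector_derivative - (M *v ?e t)) (at t within {0..})" if "t \<ge> 0" for t
    by (rule derivative_eq_intros ode[OF that] refl)+
      (simp add: minus matrix_vector_mult_diff_distrib l)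
  \<comment> \<open>The squared error is the Lyapunov function; coercivity then gives the decay rate
    \<open>2 * \<kappa>\<close>.\<close>
  have V: "((\<lambda>t. ?e t \<bullet> ?e t) has_real_derivative - 2 * (?e t \<bullet> (M *v ?e t))) (at t within {0..})"
    if "t \<ge> 0" for t
    using bounded_bilinear.has_vector_derivative[OF bounded_bilinear_inner e[OF that] e[OF that]]
    by (simp add: has_real_derivative_iff_has_vector_derivative inner_commute)
  have "?e t \<bullet> ?e t \<le> (?e 0 \<bullet> ?e 0) * exp (- (2 * \<kappa>) * t)" if "t \<ge> 0" for t
  proof (rule exp_decay_of_derivative_le[OF V _ that])
    fix t :: real assume "t \<ge> 0"
    then have "s (?e t) = 0"
      using c l by (simp add: s_def sum_subtractf)
    then show "- 2 * (?e t \<bullet> (M *v ?e t)) \<le> - (2 * \<kappa>) * (?e t \<bullet> ?e t)"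
      using pos[of "?e t"] by (simp add: s_def power2_norm_eq_inner)
  qed
  then have bound: "eventually (\<lambda>t. ?e t \<bullet> ?e t \<le> (?e 0 \<bullet> ?e 0) * exp (- (2 * \<kappa>) * t)) at_top"
    using eventually_ge_at_top[of 0] by (rule eventually_mono[rotated])
  have "((\<lambda>t. exp (- (2 * \<kappa>) * t)) \<longlongrightarrow> 0) at_top"
    using \<kappa> by (intro filterlim_compose[OF exp_at_bot]
        filterlim_tendsto_neg_mult_at_bot[OF tendsto_const _ filterlim_ident]) simp
  then have "((\<lambda>t. (?e 0 \<bullet> ?e 0) * exp (- (2 * \<kappa>) * t)) \<longlongrightarrow> 0) at_top"
    by (rule tendsto_mult_right_zero)
  then have "((\<lambda>t. ?e t \<bullet> ?e t) \<longlongrightarrow> 0) at_top"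
    by (intro tendsto_sandwich[OF _ bound tendsto_const]) simp_all
  then have "((\<lambda>t. norm (?e t)) \<longlongrightarrow> 0) at_top"
    using tendsto_real_sqrt by (fastforce simp: norm_eq_sqrt_inner)
  then have "(x \<longlongrightarrow> l) at_top"
    by (simp add: tendsto_norm_zero_iff LIM_zero_iff)
  with l show ?thesis by auto
qed

section \<open>Balance of the forcing term and coercivity of the two Laplacians\<close>

lemma sum_w_J:
  fixes \<xi> \<zeta> pd :: "'n::finite \<Rightarrow> real"
  assumes "simple_graph E"
    and "\<And>i j. (i, j) \<in> E \<Longrightarrow> \<alpha> i j = \<alpha> j i"
    and "\<And>i j. (i, j) \<in> E \<Longrightarrow> \<beta> i j = - \<beta> j i"
    and "(\<Sum>j\<in>UNIV. 1 / \<xi> j) \<noteq> 0"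
  shows "(\<Sum>i\<in>UNIV. w_J E \<alpha> \<beta> \<xi> \<zeta> pd $ i) = 0"
proof -
  \<comment> \<open>Extending by zero off the edges turns the neighbor sums into an antisymmetric
    double sum over all pairs.\<close>
  let ?b = "\<lambda>i j. if (i, j) \<in> E then \<beta> i j / (2 * \<alpha> i j) else 0"
  let ?S = "\<Sum>j\<in>UNIV. 1 / \<xi> j"
  define T where "T = (\<Sum>j\<in>UNIV. \<zeta> j / (2 * \<xi> j) + pd j)"
  have "(\<Sum>i\<in>UNIV. \<Sum>j\<in>UNIV. ?b i j) = 0"
  proof (rule sum_antisym_eq_0)
    fix i j
    show "?b i j = - ?b j i"
      using assms(1) assms(2,3)[of i j] by (auto simp: simple_graph_def dest: symD)
  qed
  then have edges: "(\<Sum>i\<in>UNIV. \<Sum>j\<in>neighbors E i. \<beta> i j / (2 * \<alpha> i j)) = 0"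
    by (simp add: neighbors_def sum.If_cases)
  \<comment> \<open>The last term of \<open>w_J\<close> splits the total \<open>T\<close> into
    shares \<open>(1 / \<xi> i) / ?S\<close> that add up to one, so it offsets the terms in
    \<open>\<zeta>\<close> and \<open>pd\<close>.\<close>
  have "(\<Sum>i\<in>UNIV. T / (\<xi> i * ?S)) = (\<Sum>i\<in>UNIV. (1 / \<xi> i) * (T / ?S))"
    by (intro sum.cong) simp_all
  also have "\<dots> = ?S * (T / ?S)"
    by (simp only: sum_distrib_right)
  also have "\<dots> = T"
    using assms(4) by simp
  finally show ?thesis
    using edges unfolding w_J_def T_def[symmetric]
    by (simp add: sum.distrib sum_subtractf sum_negf) (simp add: T_def sum.distrib)
qed

lemma adjacency_matrix_sym:
  assumes "sym E" and "\<And>i j. (i, j) \<in> E \<Longrightarrow> a i j = a j i"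
  shows "adjacency_matrix E a $ i $ j = adjacency_matrix E a $ j $ i"
  using assms by (auto simp: adjacency_matrix_def neighbors_def dest: symD)

text \<open>Used for \<open>L_G\<close>, which only has to preserve the lower bound supplied by the
  complete graph.\<close>

lemma weighted_laplacian_nonneg:
  assumes "sym E" and "\<And>i j. (i, j) \<in> E \<Longrightarrow> a i j = a j i"
    and "\<And>i j. (i, j) \<in> E \<Longrightarrow> a i j \<ge> 0"
  shows "v \<bullet> (weighted_laplacian E a *v v) \<ge> 0"
proof -
  have "adjacency_matrix E a $ i $ j = adjacency_matrix E a $ j $ i" for i j
    using assms(1,2) by (rule adjacency_matrix_sym)
  moreover have "adjacency_matrix E a $ i $ j \<ge> 0" for i j
    using assms(3) by (simp add: adjacency_matrix_def neighbors_def)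
  ultimately show ?thesis
    by (simp add: weighted_laplacian_quadratic_form sum_nonneg)
qed

text \<open>Comparison with the complete graph of constant weight \<mu>, whose Laplacian acts on
  sum-zero vectors as \<mu> times the number of vertices. Diagonal pairs contribute zero to both
  sides.\<close>

lemma complete_laplacian_coercive:
  fixes v :: "real ^ 'n"
  assumes sym: "\<And>i j. a i j = a j i" and ge: "\<And>i j. a i j \<ge> \<mu>"
    and v: "(\<Sum>i\<in>UNIV. v $ i) = 0"
  shows "v \<bullet> (weighted_laplacian complete_graph a *v v) \<ge> \<mu> * real CARD('n) * (norm v)\<^sup>2"
proof -
  have complete: "sym complete_graph"
    by (auto simp: complete_graph_def intro: symI)
  have "\<mu> * (v $ i - v $ j)\<^sup>2 \<le> adjacency_matrix complete_graph a $ i $ j * (v $ i - v $ j)\<^sup>2"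
    for i j
    using ge[of i j]
    by (auto simp: adjacency_matrix_def neighbors_def complete_graph_def mult_right_mono)
  then have "\<mu> * (\<Sum>i\<in>UNIV. \<Sum>j\<in>UNIV. (v $ i - v $ j)\<^sup>2)
      \<le> (\<Sum>i\<in>UNIV. \<Sum>j\<in>UNIV. adjacency_matrix complete_graph a $ i $ j * (v $ i - v $ j)\<^sup>2)"
    by (simp add: sum_distrib_left sum_mono)
  then show ?thesis
    unfolding weighted_laplacian_quadratic_form[OF adjacency_matrix_sym[OF complete sym]]
      sum_diff_squares[OF v] by (simp add: mult_ac)
qed

theorem mainTheorem4:
  fixes E :: "('n::finite \<times> 'n) set"
    and \<alpha> \<beta> :: "'n \<Rightarrow> 'n \<Rightarrow> real"
    and \<xi> \<zeta> pd :: "'n \<Rightarrow> real"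
    and lam :: "real \<Rightarrow> real ^ 'n"
  assumes "simple_graph E" and "connected_graph E"
    and "\<And>i j. (i, j) \<in> E \<Longrightarrow> \<alpha> i j = \<alpha> j i"
    and "\<And>i j. (i, j) \<in> E \<Longrightarrow> \<alpha> i j > 0"
    and "\<And>i j. (i, j) \<in> E \<Longrightarrow> \<beta> i j = - \<beta> j i"
    and "\<And>i. \<xi> i > 0"
    and "\<And>t. t \<ge> 0 \<Longrightarrow>
      (lam has_vector_derivative (- (L_G E \<alpha> + L_G_k \<xi>) *v lam t + w_J E \<alpha> \<beta> \<xi> \<zeta> pd))
        (at t within {0..})"
  shows "\<exists>l. (lam \<longlongrightarrow> l) at_top \<and>
    (L_G E \<alpha> + L_G_k \<xi>) *v l - w_J E \<alpha> \<beta> \<xi> \<zeta> pd = 0"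
proof -
  let ?a = "\<lambda>i j. 1 / (4 * \<alpha> i j)"
  let ?S = "\<Sum>l\<in>UNIV. 1 / \<xi> l"
  let ?k = "\<lambda>i j. (1 / (2 * \<xi> j)) / (\<xi> i * ?S)"
  have S: "?S > 0"
    using assms(6) by (intro sum_pos) auto
  have symE: "sym E"
    using assms(1) by (simp add: simple_graph_def)
  have symK: "sym complete_graph"
    by (auto simp: complete_graph_def intro: symI)
  have a_sym: "?a i j = ?a j i" if "(i, j) \<in> E" for i j
    using assms(3)[OF that] by simp
  \<comment> \<open>Despite its asymmetric form, the weight is
    \<open>1 / (2 * \<xi> i * \<xi> j * ?S)\<close>.\<close>
  have k_sym: "?k i j = ?k j i" for i j
    by (simp add: mult_ac)
  have a_adj: "adjacency_matrix E ?a $ i $ j = adjacency_matrix E ?a $ j $ i" for i j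
    using symE a_sym by (rule adjacency_matrix_sym)
  have k_adj: "adjacency_matrix complete_graph ?k $ i $ j
      = adjacency_matrix complete_graph ?k $ j $ i" for i j
    using symK k_sym by (rule adjacency_matrix_sym)
  have k_pos: "?k i j > 0" for i j
    using assms(6)[of i] assms(6)[of j] S by simp
  \<comment> \<open>The minimum includes the diagonal pairs, where the formula is still positive;
    the range is therefore nonempty even for a single vertex.\<close>
  define \<mu> where "\<mu> = Min (range (\<lambda>(i, j). ?k i j))"
  have \<mu>_le: "\<mu> \<le> ?k i j" for i j
    unfolding \<mu>_def by (rule Min_le) auto
  have "\<mu> > 0"
    unfolding \<mu>_def using k_pos by (subst Min_gr_iff) auto
  show ?thesis
  proof (rule consensus_flow_converges[OF _ _ _ _ assms(7)])
    show "(\<Sum>i\<in>UNIV. ((L_G E \<alpha> + L_G_k \<xi>) *v v) $ i) = 0" for v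
      using sum_weighted_laplacian_mult[OF a_adj, where v = v]
        sum_weighted_laplacian_mult[OF k_adj, where v = v]
      by (simp add: L_G_def L_G_k_def matrix_vector_mult_add_rdistrib sum.distrib)
    show "\<mu> * real CARD('n) * (norm v)\<^sup>2 \<le> v \<bullet> ((L_G E \<alpha> + L_G_k \<xi>) *v v)"
      if "(\<Sum>i\<in>UNIV. v $ i) = 0" for v :: "real ^ 'n"
    proof -
      have "v \<bullet> (L_G E \<alpha> *v v) \<ge> 0"
        unfolding L_G_def
        by (rule weighted_laplacian_nonneg[OF symE a_sym]) (use assms(4) in \<open>auto simp: less_imp_le\<close>)
      moreover have "v \<bullet> (L_G_k \<xi> *v v) \<ge> \<mu> * real CARD('n) * (norm v)\<^sup>2"
        unfolding L_G_k_def by (rule complete_laplacian_coercive[OF k_sym \<mu>_le that])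
      ultimately show ?thesis
        by (simp add: matrix_vector_mult_add_rdistrib inner_right_distrib)
    qed
    show "\<mu> * real CARD('n) > 0"
      using \<open>\<mu> > 0\<close> by simp
    show "(\<Sum>i\<in>UNIV. w_J E \<alpha> \<beta> \<xi> \<zeta> pd $ i) = 0"
      using sum_w_J[OF assms(1,3,5)] S by force
  qed
qed

end
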